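(* Let $G = C \wr \mathbb{Z}$ be the restricted wreath product, where $C$ is a non-trivial (finite or infinite) cyclic group. Then there is a finite generating set $S$ of $G$ such that $\mathrm{dc}_S(G) = 0$.
   Context: Restricted wreath product: for groups $K$ and $H$, $K \wr H$ is the semidirect product $B \rtimes H$, where the base $B$ is the group (under pointwise multiplication) of all functions $f : H \to K$ with $f(h) \neq 1$ for only finitely many $h \in H$, and the head $H$ acts on $B$ by $(k^{-1} f k)(h) := f(hk^{-1})$ for $h,k \in H$, $f\in B$. Word length and balls: if $G$ is a group with finite generating set $S$, then $|g|_S$ is the least length of a word in $S \cup S^{-1}$ representing $g \in G$, and $\mathbb{B}_S(n) = \{g \in G : |g|_S \leqslant n\}$ for $n \in \mathbb{N}$ (the ball of radius $n$ in the Cayley graph). Degree of commutativity: for a group $G$ with finite generating set $S$, $$\mathrm{dc}_S(G) := \limsup_{n \to \infty} \frac{|\{(a,b) \in \mathbb{B}_S(n)^2 : ab = ba\}|}{|\mathbb{B}_S(n)|^2}.$$ *)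

theory Defs
  imports "HOL-Algebra.Algebra" "HOL-Library.Extended_Real"
begin

section \<open>Restricted wreath products\<close>

text \<open>
  The argument \<open>act\<close> is a right action by automorphisms, \<open>act k b\<close> standing for the conjugate
  \<open>k\<^sup>-\<^sup>1 b k\<close>, and the pair \<open>(b, h)\<close> stands for the product \<open>b h\<close>. Hence
  \<open>(b h) (b' h') = b (h b' h\<^sup>-\<^sup>1) (h h')\<close>, where \<open>h b' h\<^sup>-\<^sup>1\<close> is the image of \<open>b'\<close> under the
  action of \<open>h\<^sup>-\<^sup>1\<close>.
\<close>

definition semidirect_product ::
  "('b, 'x) monoid_scheme \<Rightarrow> ('h, 'y) monoid_scheme \<Rightarrow> ('h \<Rightarrow> 'b \<Rightarrow> 'b) \<Rightarrow> ('b \<times> 'h) monoid"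
  where "semidirect_product B H act =
    \<lparr>carrier = carrier B \<times> carrier H,
     monoid.mult = (\<lambda>(b, h) (b', h'). (b \<otimes>\<^bsub>B\<^esub> act (inv\<^bsub>H\<^esub> h) b', h \<otimes>\<^bsub>H\<^esub> h')),
     one = (\<one>\<^bsub>B\<^esub>, \<one>\<^bsub>H\<^esub>)\<rparr>"

text \<open>
  The elements of \<^term>\<open>sum_group I G\<close> are extensional functions, so the translates below are
  restricted to \<^term>\<open>carrier H\<close>.
\<close>

definition translate :: "('h, 'y) monoid_scheme \<Rightarrow> 'h \<Rightarrow> ('h \<Rightarrow> 'k) \<Rightarrow> ('h \<Rightarrow> 'k)"
  where "translate H k f = (\<lambda>h\<in>carrier H. f (h \<otimes>\<^bsub>H\<^esub> inv\<^bsub>H\<^esub> k))"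

definition restricted_wreath_product ::
  "('k, 'x) monoid_scheme \<Rightarrow> ('h, 'y) monoid_scheme \<Rightarrow> (('h \<Rightarrow> 'k) \<times> 'h) monoid"
  where "restricted_wreath_product K H =
    semidirect_product (sum_group (carrier H) (\<lambda>_. K)) H (translate H)"


section \<open>Word length, balls and the degree of commutativity\<close>

definition finite_generating_set :: "('g, 'x) monoid_scheme \<Rightarrow> 'g set \<Rightarrow> bool"
  where "finite_generating_set G S \<longleftrightarrow> finite S \<and> S \<subseteq> carrier G \<and> generate G S = carrier G"

text \<open>The word length is meaningful only for elements of \<^term>\<open>generate G S\<close>.\<close>

definition word_length :: "('g, 'x) monoid_scheme \<Rightarrow> 'g set \<Rightarrow> 'g \<Rightarrow> nat"
  where "word_length G S g =
    (LEAST n. \<exists>w. set w \<subseteq> S \<union> m_inv G ` S \<and> length w = n \<and> foldr (\<otimes>\<^bsub>G\<^esub>) w \<one>\<^bsub>G\<^esub> = g)"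

definition word_ball :: "('g, 'x) monoid_scheme \<Rightarrow> 'g set \<Rightarrow> nat \<Rightarrow> 'g set"
  where "word_ball G S n = {g \<in> carrier G. word_length G S g \<le> n}"

definition degree_of_commutativity :: "('g, 'x) monoid_scheme \<Rightarrow> 'g set \<Rightarrow> ereal"
  where "degree_of_commutativity G S =
    limsup (\<lambda>n. ereal
      (real (card {(a, b) \<in> word_ball G S n \<times> word_ball G S n. a \<otimes>\<^bsub>G\<^esub> b = b \<otimes>\<^bsub>G\<^esub> a}) /
       (real (card (word_ball G S n)))\<^sup>2))"


section \<open>Basic facts\<close>

lemma carrier_restricted_wreath_product:
  assumes "group K"
  shows "carrier (restricted_wreath_product K H) =
    {f \<in> carrier H \<rightarrow>\<^sub>E carrier K. finite {h \<in> carrier H. f h \<noteq> \<one>\<^bsub>K\<^esub>}} \<times> carrier H"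
  using assms
  by (simp add: restricted_wreath_product_def semidirect_product_def carrier_sum_group)

lemma one_restricted_wreath_product:
  "\<one>\<^bsub>restricted_wreath_product K H\<^esub> = (\<lambda>h\<in>carrier H. \<one>\<^bsub>K\<^esub>, \<one>\<^bsub>H\<^esub>)"
  by (simp add: restricted_wreath_product_def semidirect_product_def)

lemma mult_restricted_wreath_product:
  assumes "group H" "k \<in> carrier H"
  shows "(f, k) \<otimes>\<^bsub>restricted_wreath_product K H\<^esub> (f', k') =
    (\<lambda>h\<in>carrier H. f h \<otimes>\<^bsub>K\<^esub> f' (h \<otimes>\<^bsub>H\<^esub> k), k \<otimes>\<^bsub>H\<^esub> k')"
  using assms
  by (auto simp: restricted_wreath_product_def semidirect_product_def translate_def)

lemma finite_support_translate:
  assumes "group H" "k \<in> carrier H" "finite {h \<in> carrier H. f h \<noteq> e}"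
  shows "finite {h \<in> carrier H. f (h \<otimes>\<^bsub>H\<^esub> k) \<noteq> e}"
proof -
  interpret H: group H by fact
  have "inj_on (\<lambda>h. h \<otimes>\<^bsub>H\<^esub> k) {h \<in> carrier H. f (h \<otimes>\<^bsub>H\<^esub> k) \<noteq> e}"
    using assms(2) by (auto simp: inj_on_def)
  moreover have "(\<lambda>h. h \<otimes>\<^bsub>H\<^esub> k) ` {h \<in> carrier H. f (h \<otimes>\<^bsub>H\<^esub> k) \<noteq> e} \<subseteq> {h \<in> carrier H. f h \<noteq> e}"
    using assms(2) by auto
  ultimately show ?thesis
    by (rule finite_imageD[OF finite_subset[OF _ assms(3)], rotated])
qed

lemma group_restricted_wreath_product:
  assumes "group K" "group H"
  shows "group (restricted_wreath_product K H)" (is "group ?W")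
proof -
  interpret K: group K by fact
  interpret H: group H by fact
  note carr = carrier_restricted_wreath_product[OF assms(1)]
  note mult = mult_restricted_wreath_product[OF assms(2)]
  show ?thesis
  proof (rule groupI)
    fix x y assume "x \<in> carrier ?W" "y \<in> carrier ?W"
    then obtain f k f' k' where
      xy: "x = (f, k)" "y = (f', k')" "k \<in> carrier H" "k' \<in> carrier H"
        "f \<in> carrier H \<rightarrow>\<^sub>E carrier K" "f' \<in> carrier H \<rightarrow>\<^sub>E carrier K"
        "finite {h \<in> carrier H. f h \<noteq> \<one>\<^bsub>K\<^esub>}" "finite {h \<in> carrier H. f' h \<noteq> \<one>\<^bsub>K\<^esub>}"
      by (auto simp: carr)
    have "finite {h \<in> carrier H. f' (h \<otimes>\<^bsub>H\<^esub> k) \<noteq> \<one>\<^bsub>K\<^esub>}"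
      by (rule finite_support_translate) (use xy assms in simp_all)
    then have "finite ({h \<in> carrier H. f h \<noteq> \<one>\<^bsub>K\<^esub>} \<union> {h \<in> carrier H. f' (h \<otimes>\<^bsub>H\<^esub> k) \<noteq> \<one>\<^bsub>K\<^esub>})"
      using xy by simp
    then have "finite {h \<in> carrier H. f h \<otimes>\<^bsub>K\<^esub> f' (h \<otimes>\<^bsub>H\<^esub> k) \<noteq> \<one>\<^bsub>K\<^esub>}"
      by (rule finite_subset[rotated]) auto
    moreover have "(\<lambda>h\<in>carrier H. f h \<otimes>\<^bsub>K\<^esub> f' (h \<otimes>\<^bsub>H\<^esub> k)) \<in> carrier H \<rightarrow>\<^sub>E carrier K"
      using xy by (auto simp: PiE_iff)
    ultimately show "x \<otimes>\<^bsub>?W\<^esub> y \<in> carrier ?W"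
      using xy by (simp add: mult carr cong: conj_cong)
  next
    show "\<one>\<^bsub>?W\<^esub> \<in> carrier ?W"
      by (auto simp: carr one_restricted_wreath_product cong: conj_cong)
  next
    fix x y z assume "x \<in> carrier ?W" "y \<in> carrier ?W" "z \<in> carrier ?W"
    then show "x \<otimes>\<^bsub>?W\<^esub> y \<otimes>\<^bsub>?W\<^esub> z = x \<otimes>\<^bsub>?W\<^esub> (y \<otimes>\<^bsub>?W\<^esub> z)"
      by (auto simp: carr mult PiE_iff K.m_assoc H.m_assoc intro!: restrict_ext)
  next
    fix x assume "x \<in> carrier ?W"
    then show "\<one>\<^bsub>?W\<^esub> \<otimes>\<^bsub>?W\<^esub> x = x"
      by (auto simp: carr mult one_restricted_wreath_product PiE_iff extensional_def fun_eq_iff)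
  next
    fix x assume "x \<in> carrier ?W"
    then obtain f k where
      x: "x = (f, k)" "k \<in> carrier H" "f \<in> carrier H \<rightarrow>\<^sub>E carrier K"
        "finite {h \<in> carrier H. f h \<noteq> \<one>\<^bsub>K\<^esub>}"
      by (auto simp: carr)
    let ?g = "\<lambda>h\<in>carrier H. inv\<^bsub>K\<^esub> f (h \<otimes>\<^bsub>H\<^esub> inv\<^bsub>H\<^esub> k)"
    have fin: "finite {h \<in> carrier H. f (h \<otimes>\<^bsub>H\<^esub> inv\<^bsub>H\<^esub> k) \<noteq> \<one>\<^bsub>K\<^esub>}"
      by (rule finite_support_translate) (use x assms in simp_all)
    have "finite {h \<in> carrier H. ?g h \<noteq> \<one>\<^bsub>K\<^esub>}"
      by (rule finite_subset[OF _ fin]) auto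
    then have "(?g, inv\<^bsub>H\<^esub> k) \<in> carrier ?W"
      using x by (auto simp: carr PiE_iff)
    moreover have "(?g, inv\<^bsub>H\<^esub> k) \<otimes>\<^bsub>?W\<^esub> x = \<one>\<^bsub>?W\<^esub>"
      using x by (auto simp: mult one_restricted_wreath_product PiE_iff intro!: restrict_ext)
    ultimately show "\<exists>y\<in>carrier ?W. y \<otimes>\<^bsub>?W\<^esub> x = \<one>\<^bsub>?W\<^esub>" by blast
  qed
qed

text \<open>Conjugation by an element of the head is the prescribed action on the base.\<close>

lemma conj_restricted_wreath_product:
  fixes K :: "('k, 'x) monoid_scheme" and H :: "('h, 'y) monoid_scheme"
  assumes "group K" "group H" "k \<in> carrier H" "f \<in> carrier (sum_group (carrier H) (\<lambda>_. K))"
  defines "W \<equiv> restricted_wreath_product K H"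
  defines "t \<equiv> (\<one>\<^bsub>sum_group (carrier H) (\<lambda>_. K)\<^esub>, k)"
  shows "inv\<^bsub>W\<^esub> t \<otimes>\<^bsub>W\<^esub> (f, \<one>\<^bsub>H\<^esub>) \<otimes>\<^bsub>W\<^esub> t =
    (\<lambda>h\<in>carrier H. f (h \<otimes>\<^bsub>H\<^esub> inv\<^bsub>H\<^esub> k), \<one>\<^bsub>H\<^esub>)"
proof -
  interpret K: group K by fact
  interpret H: group H by fact
  interpret W: group W
    unfolding W_def by (rule group_restricted_wreath_product) fact+
  note mult = mult_restricted_wreath_product[OF assms(2), of _ K, folded W_def]
  note one = one_restricted_wreath_product[of K H, folded W_def]
  note carr = carrier_restricted_wreath_product[OF assms(1), of H, folded W_def]
  let ?t' = "(\<one>\<^bsub>sum_group (carrier H) (\<lambda>_. K)\<^esub>, inv\<^bsub>H\<^esub> k)"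
  have "t \<in> carrier W" "?t' \<in> carrier W"
    using assms(3) by (auto simp: t_def carr cong: conj_cong)
  moreover have "?t' \<otimes>\<^bsub>W\<^esub> t = \<one>\<^bsub>W\<^esub>"
    using assms(3) by (auto simp: t_def mult one intro!: restrict_ext)
  ultimately have "inv\<^bsub>W\<^esub> t = ?t'"
    by (intro W.inv_equality)
  moreover have "f \<in> carrier H \<rightarrow>\<^sub>E carrier K"
    using assms(4) by (simp add: carrier_sum_group assms(1))
  ultimately show ?thesis
    using assms(3) by (auto simp: t_def mult PiE_iff intro!: restrict_ext)
qed

end

(*
  Let c generate C and take S = {c at position 0, t} with t a generator of the head Z. An element
  with lamp configuration f and final position k has length |f| + 2a + 2b - |k|, where [-a, b] is
  the hull of 0, k and the support of f and |f| is the total word length of the lamps. Let B be the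
  n-ball and B0 its intersection with the base.

  A non-trivial base element commutes only with base elements, and if g lies outside the base then
  an element commuting with g is determined by its image in Z. Hence there are at most
  |B0|^2 + (2n + 2)|B| commuting pairs. If (f, 0) lies in the n-ball then so does (f, k) for all k
  in [-a, b], so the base elements with max(a, b) >= M make up at most the fraction 1/(M + 1) of B;
  the remaining ones are polynomially many for fixed M, whereas |B| grows exponentially.
*)

theory Submission
  imports Defs "HOL-Real_Asymp.Real_Asymp"
begin

section \<open>Words and balls\<close>

text \<open>The predicate under \<open>LEAST\<close> in \<open>word_length\<close>, split off so
  that inductions can run over words of an exact length.\<close>

definition spells :: "('g, 'x) monoid_scheme \<Rightarrow> 'g set \<Rightarrow> nat \<Rightarrow> 'g \<Rightarrow> bool"
  where "spells G S n g \<longleftrightarrow>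
    (\<exists>w. set w \<subseteq> S \<union> m_inv G ` S \<and> length w = n \<and> foldr (\<otimes>\<^bsub>G\<^esub>) w \<one>\<^bsub>G\<^esub> = g)"

lemma word_length_eq_Least: "word_length G S g = (LEAST n. spells G S n g)"
  by (simp add: word_length_def spells_def)

text \<open>The premise makes the minimum attained; \<open>LEAST\<close> of an unsatisfiable
  predicate would be an unspecified number.\<close>

lemma word_length_le_iff:
  assumes "spells G S m g"
  shows "word_length G S g \<le> n \<longleftrightarrow> (\<exists>l\<le>n. spells G S l g)"
  unfolding word_length_eq_Least
  using LeastI[of "\<lambda>n. spells G S n g", OF assms] Least_le[of "\<lambda>n. spells G S n g"] le_trans
  by blast

lemma spells_0: "spells G S 0 g \<longleftrightarrow> g = \<one>\<^bsub>G\<^esub>"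
  by (auto simp: spells_def)

context group
begin

lemma letters_closed:
  assumes "S \<subseteq> carrier G"
  shows "S \<union> m_inv G ` S \<subseteq> carrier G"
  using assms by auto

lemma foldr_mult_closed:
  assumes "set w \<subseteq> carrier G"
  shows "foldr (\<otimes>) w \<one> \<in> carrier G"
  using assms by (induction w) auto

lemma foldr_mult_append:
  assumes "set u \<subseteq> carrier G" "set v \<subseteq> carrier G"
  shows "foldr (\<otimes>) (u @ v) \<one> = foldr (\<otimes>) u \<one> \<otimes> foldr (\<otimes>) v \<one>"
  using assms by (induction u) (auto simp: m_assoc foldr_mult_closed)

lemma spells_closed:
  assumes "S \<subseteq> carrier G" "spells G S n g"
  shows "g \<in> carrier G"
  using assms letters_closed[OF assms(1)] foldr_mult_closed unfolding spells_def
  by (metis subset_trans)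

lemma spells_mult:
  assumes S: "S \<subseteq> carrier G" and "spells G S m g" "spells G S n h"
  shows "spells G S (m + n) (g \<otimes> h)"
proof -
  obtain u v where uv: "set u \<subseteq> S \<union> m_inv G ` S" "length u = m" "foldr (\<otimes>) u \<one> = g"
    "set v \<subseteq> S \<union> m_inv G ` S" "length v = n" "foldr (\<otimes>) v \<one> = h"
    using assms by (auto simp: spells_def)
  then have "foldr (\<otimes>) (u @ v) \<one> = g \<otimes> h"
    using foldr_mult_append[of u v] letters_closed[OF S] by (metis subset_trans)
  with uv show ?thesis
    unfolding spells_def by (intro exI[of _ "u @ v"]) auto
qed

lemma spells_letter:
  assumes "S \<subseteq> carrier G" "s \<in> S \<union> m_inv G ` S"
  shows "spells G S (Suc 0) s"
  unfolding spells_def using assms letters_closed[OF assms(1)]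
  by (intro exI[of _ "[s]"]) auto

text \<open>The last letter is removed, although \<open>foldr\<close> recurses on the first, because
  right multiplication is what moves the walker below.\<close>

lemma spells_Suc_cases:
  assumes S: "S \<subseteq> carrier G" and "spells G S (Suc n) g"
  obtains h s where "spells G S n h" "s \<in> S \<union> m_inv G ` S" "g = h \<otimes> s"
proof -
  obtain w where w: "set w \<subseteq> S \<union> m_inv G ` S" "length w = Suc n" "foldr (\<otimes>) w \<one> = g"
    using assms by (auto simp: spells_def)
  obtain v s where v: "w = v @ [s]"
    using w(2) by (cases w rule: rev_cases) auto
  have "g = foldr (\<otimes>) v \<one> \<otimes> s"
    using foldr_mult_append[of v "[s]"] w v subset_trans[OF w(1) letters_closed[OF S]] by simp
  moreover have "spells G S n (foldr (\<otimes>) v \<one>)"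
    using w v by (auto simp: spells_def)
  ultimately show thesis
    using that w v by auto
qed

lemma spells_one_parameter_subgroup:
  fixes f :: "int \<Rightarrow> 'a"
  assumes S: "S \<subseteq> carrier G" and f: "f 1 \<in> S \<union> m_inv G ` S" "f (- 1) \<in> S \<union> m_inv G ` S"
    and hom: "f 0 = \<one>" "\<And>i j. f i \<otimes> f j = f (i + j)"
  shows "spells G S (nat \<bar>i\<bar>) (f i)"
proof -
  have "spells G S n (f (s * int n))" if "f s \<in> S \<union> m_inv G ` S" for n s
  proof (induction n)
    case 0 then show ?case by (simp add: spells_0 hom)
  next
    case (Suc n)
    from spells_mult[OF S Suc spells_letter[OF S that]] show ?case
      by (simp add: hom algebra_simps)
  qed
  from this[OF f(1), of "nat \<bar>i\<bar>"] this[OF f(2), of "nat \<bar>i\<bar>"] show ?thesis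
    by (cases "0 \<le> i") simp_all
qed

lemma spells_in_generate:
  assumes "S \<subseteq> carrier G" "spells G S n g"
  shows "g \<in> generate G S"
proof -
  have "foldr (\<otimes>) w \<one> \<in> generate G S" if "set w \<subseteq> S \<union> m_inv G ` S" for w
    using that by (induction w) (auto intro: generate.intros)
  then show ?thesis
    using assms by (auto simp: spells_def)
qed

lemma finite_spells:
  assumes "finite S"
  shows "finite {g. \<exists>l\<le>n. spells G S l g}"
proof (rule finite_subset)
  show "{g. \<exists>l\<le>n. spells G S l g} \<subseteq>
      (\<lambda>w. foldr (\<otimes>) w \<one>) ` {w. set w \<subseteq> S \<union> m_inv G ` S \<and> length w \<le> n}"
    by (auto simp: spells_def image_iff)
  show "finite \<dots>"
    using assms by (intro finite_imageI finite_lists_length_le) auto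
qed

end


section \<open>The lamplighter group of a cyclic group\<close>

text \<open>Lamps are encoded by integer exponents of a generator, also when the cyclic group is
  finite. Exponents are then not unique, and membership in a ball asks for some representative that
  is short enough.\<close>

definition l1_norm :: "(int \<Rightarrow> int) \<Rightarrow> int"
  where "l1_norm \<phi> = (\<Sum>x | \<phi> x \<noteq> 0. \<bar>\<phi> x\<bar>)"

lemma l1_norm_eq:
  assumes "finite I" "\<And>x. \<phi> x \<noteq> 0 \<Longrightarrow> x \<in> I"
  shows "l1_norm \<phi> = (\<Sum>x\<in>I. \<bar>\<phi> x\<bar>)"
  unfolding l1_norm_def using assms by (intro sum.mono_neutral_left) auto

lemma l1_norm_upd:
  assumes "finite I" "\<And>x. \<phi> x \<noteq> 0 \<Longrightarrow> x \<in> I"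
  shows "l1_norm (\<phi>(k := \<phi> k + i)) \<le> l1_norm \<phi> + \<bar>i\<bar>"
proof -
  have "l1_norm (\<phi>(k := \<phi> k + i)) = (\<Sum>x\<in>insert k I. \<bar>(\<phi>(k := \<phi> k + i)) x\<bar>)"
    by (rule l1_norm_eq) (use assms in \<open>auto split: if_splits\<close>)
  also have "\<dots> \<le> (\<Sum>x\<in>insert k I. \<bar>\<phi> x\<bar> + (if x = k then \<bar>i\<bar> else 0))"
    by (intro sum_mono) auto
  also have "\<dots> = (\<Sum>x\<in>insert k I. \<bar>\<phi> x\<bar>) + \<bar>i\<bar>"
    using assms(1) by (simp add: sum.distrib)
  also have "(\<Sum>x\<in>insert k I. \<bar>\<phi> x\<bar>) = l1_norm \<phi>"
    by (rule l1_norm_eq[symmetric]) (use assms in auto)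
  finally show ?thesis .
qed

text \<open>
  A walk from \<open>0\<close> to \<open>k\<close> covering \<open>[-a, b]\<close> has at least \<open>2a + 2b - |k|\<close> steps, and
  \<^term>\<open>l1_norm \<phi>\<close> counts the lamp moves.
\<close>

definition fits :: "nat \<Rightarrow> (int \<Rightarrow> int) \<Rightarrow> int \<Rightarrow> int \<Rightarrow> int \<Rightarrow> bool"
  where "fits n \<phi> k a b \<longleftrightarrow> 0 \<le> a \<and> 0 \<le> b \<and> - a \<le> k \<and> k \<le> b \<and>
    (\<forall>x. \<phi> x \<noteq> 0 \<longrightarrow> x \<in> {-a..b}) \<and> l1_norm \<phi> + 2 * a + 2 * b - \<bar>k\<bar> \<le> int n"

lemma l1_norm_nonneg: "0 \<le> l1_norm \<phi>"
  by (simp add: l1_norm_def sum_nonneg)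

section \<open>Exponent coordinates on the wreath product\<close>

locale lamplighter = C: group C for C :: "('a, 'x) monoid_scheme" +
  fixes c :: 'a
  assumes c_closed: "c \<in> carrier C"
    and carrier_eq: "carrier C = range (\<lambda>i::int. c [^]\<^bsub>C\<^esub> i)"
    and c_not_one: "c \<noteq> \<one>\<^bsub>C\<^esub>"
begin

definition W :: "((int \<Rightarrow> 'a) \<times> int) monoid"
  where "W = restricted_wreath_product C integer_group"

text \<open>
  Right multiplication by a base element supported at \<open>0\<close> changes the value of \<^term>\<open>fst (f, k)\<close>
  at \<open>- k\<close>; the reflection makes the position of the walker equal to \<open>k\<close>.
\<close>

definition elt :: "(int \<Rightarrow> int) \<Rightarrow> int \<Rightarrow> (int \<Rightarrow> 'a) \<times> int"
  where "elt \<phi> k = (\<lambda>h. c [^]\<^bsub>C\<^esub> \<phi> (- h), k)"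

definition lamp :: "int \<Rightarrow> (int \<Rightarrow> 'a) \<times> int"
  where "lamp i = elt ((\<lambda>_. 0)(0 := i)) 0"

definition shift :: "int \<Rightarrow> (int \<Rightarrow> 'a) \<times> int"
  where "shift k = elt (\<lambda>_. 0) k"

definition S :: "((int \<Rightarrow> 'a) \<times> int) set"
  where "S = {lamp 1, shift 1}"

sublocale W: group W
  unfolding W_def by (rule group_restricted_wreath_product) (auto intro: C.is_group)

lemma pow_add: "c [^]\<^bsub>C\<^esub> (i + j :: int) = c [^]\<^bsub>C\<^esub> i \<otimes>\<^bsub>C\<^esub> c [^]\<^bsub>C\<^esub> j"
  using c_closed by (simp add: C.int_pow_mult)

lemma carrier_W: "carrier W = {f. range f \<subseteq> carrier C \<and> finite {h. f h \<noteq> \<one>\<^bsub>C\<^esub>}} \<times> UNIV"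
  by (auto simp: W_def carrier_restricted_wreath_product[OF C.is_group] PiE_iff)

lemma mult_W: "(f, k) \<otimes>\<^bsub>W\<^esub> (f', k') = (\<lambda>h. f h \<otimes>\<^bsub>C\<^esub> f' (h + k), k + k')"
  by (simp add: W_def mult_restricted_wreath_product restrict_def)

lemma elt_mult: "elt \<phi> k \<otimes>\<^bsub>W\<^esub> elt \<psi> l = elt (\<lambda>x. \<phi> x + \<psi> (x - k)) (k + l)"
  by (simp add: elt_def mult_W pow_add)

lemma one_W: "\<one>\<^bsub>W\<^esub> = elt (\<lambda>_. 0) 0"
  by (simp add: W_def one_restricted_wreath_product elt_def restrict_def)

lemma elt_closed:
  assumes "finite {x. \<phi> x \<noteq> 0}"
  shows "elt \<phi> k \<in> carrier W"
proof -
  have "{h. c [^]\<^bsub>C\<^esub> \<phi> (- h) \<noteq> \<one>\<^bsub>C\<^esub>} \<subseteq> uminus ` {x. \<phi> x \<noteq> 0}"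
  proof
    fix h assume "h \<in> {h. c [^]\<^bsub>C\<^esub> \<phi> (- h) \<noteq> \<one>\<^bsub>C\<^esub>}"
    then have "\<phi> (- h) \<noteq> 0" by force
    then show "h \<in> uminus ` {x. \<phi> x \<noteq> 0}"
      by (intro image_eqI[of _ _ "- h"]) auto
  qed
  then show ?thesis
    using assms c_closed by (auto simp: carrier_W elt_def intro: finite_subset)
qed

lemma elt_cases:
  assumes "g \<in> carrier W"
  obtains \<phi> k where "g = elt \<phi> k" "finite {x. \<phi> x \<noteq> 0}"
proof -
  obtain f k where g: "g = (f, k)" "range f \<subseteq> carrier C" "finite {h. f h \<noteq> \<one>\<^bsub>C\<^esub>}"
    using assms by (auto simp: carrier_W)
  have "\<forall>h. \<exists>i::int. f h = c [^]\<^bsub>C\<^esub> i"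
    using g(2) carrier_eq by auto
  then obtain e :: "int \<Rightarrow> int" where e: "\<And>h. f h = c [^]\<^bsub>C\<^esub> e h"
    by metis
  \<comment> \<open>For finite \<open>C\<close> a nonzero exponent may represent the identity;
    resetting it to 0 keeps the support of \<open>\<phi>\<close> finite.\<close>
  define \<phi> where "\<phi> x = (if f (- x) = \<one>\<^bsub>C\<^esub> then 0 else e (- x))" for x
  have "g = elt \<phi> k"
    using e by (auto simp: g elt_def \<phi>_def)
  moreover have "{x. \<phi> x \<noteq> 0} \<subseteq> uminus ` {h. f h \<noteq> \<one>\<^bsub>C\<^esub>}"
    by (auto simp: \<phi>_def image_iff split: if_splits intro: minus_minus[symmetric])
  then have "finite {x. \<phi> x \<noteq> 0}"
    using g(3) by (auto intro: finite_subset)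
  ultimately show thesis
    using that by blast
qed

lemma lamp_closed: "lamp i \<in> carrier W" and shift_closed: "shift k \<in> carrier W"
  unfolding lamp_def shift_def by (auto intro!: elt_closed)

lemma lamp_add: "lamp i \<otimes>\<^bsub>W\<^esub> lamp j = lamp (i + j)"
  by (auto simp: lamp_def elt_mult intro!: arg_cong2[of _ _ _ _ elt])

lemma shift_add: "shift k \<otimes>\<^bsub>W\<^esub> shift l = shift (k + l)"
  by (simp add: shift_def elt_mult)

lemma shift_0: "shift 0 = \<one>\<^bsub>W\<^esub>" and lamp_0: "lamp 0 = \<one>\<^bsub>W\<^esub>"
  by (simp_all add: shift_def lamp_def one_W fun_upd_idem)

lemma inv_lamp: "inv\<^bsub>W\<^esub> lamp i = lamp (- i)"
  by (rule W.inv_equality) (auto simp: lamp_add lamp_0 lamp_closed)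

lemma inv_shift: "inv\<^bsub>W\<^esub> shift k = shift (- k)"
  by (rule W.inv_equality) (auto simp: shift_add shift_0 shift_closed)

lemma S_closed: "S \<subseteq> carrier W"
  by (simp add: S_def lamp_closed shift_closed)

lemma letters: "S \<union> m_inv W ` S = {lamp 1, lamp (- 1), shift 1, shift (- 1)}"
  by (auto simp: S_def inv_lamp inv_shift)

text \<open>This and the next two rules are the walker model: letters on the right instruct the
  walker standing at \<open>k\<close>, while a shift on the left translates the whole
  itinerary.\<close>

lemma elt_lamp: "elt \<phi> k \<otimes>\<^bsub>W\<^esub> lamp i = elt (\<phi>(k := \<phi> k + i)) k"
  by (auto simp: lamp_def elt_mult intro!: arg_cong2[of _ _ _ _ elt])

lemma elt_shift: "elt \<phi> k \<otimes>\<^bsub>W\<^esub> shift l = elt \<phi> (k + l)"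
  by (simp add: shift_def elt_mult)

lemma shift_elt: "shift l \<otimes>\<^bsub>W\<^esub> elt \<phi> k = elt (\<lambda>x. \<phi> (x - l)) (l + k)"
  by (simp add: shift_def elt_mult)

section \<open>Word length as the cost of a walk\<close>

lemma fits_lamp:
  assumes "fits n \<phi> k a b" "\<bar>i\<bar> = 1"
  shows "fits (Suc n) (\<phi>(k := \<phi> k + i)) k a b"
  using assms l1_norm_upd[of "{-a..b}" \<phi> k i] by (auto simp: fits_def)

text \<open>Inside the hull only \<open>|k|\<close> changes, by one. A step out of the hull raises
  \<open>2 * a\<close> or \<open>2 * b\<close> by two, but the walker then moves away from 0, so
  \<open>|k|\<close> grows by one and the net cost is again one.\<close>

lemma fits_shift:
  assumes "fits n \<phi> k a b" "\<bar>i\<bar> = 1"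
  shows "fits (Suc n) \<phi> (k + i) (max a (- (k + i))) (max b (k + i))"
  using assms by (force simp: fits_def max_def)

text \<open>The lower bound for word length. The witness \<open>\<phi>\<close> counts the lamp moves
  as integers, without reduction modulo the order of \<open>c\<close>.\<close>

lemma spells_imp_fits:
  assumes "spells W S n g"
  shows "\<exists>\<phi> k a b. g = elt \<phi> k \<and> fits n \<phi> k a b"
  using assms
proof (induction n arbitrary: g)
  case 0
  have "fits 0 (\<lambda>_. 0) 0 0 0"
    by (simp add: fits_def l1_norm_def)
  then show ?case
    using 0 by (auto simp: spells_0 one_W)
next
  case (Suc n)
  obtain h s where h: "spells W S n h" "s \<in> S \<union> m_inv W ` S" "g = h \<otimes>\<^bsub>W\<^esub> s"
    using W.spells_Suc_cases[OF S_closed Suc.prems] by blast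
  obtain \<phi> k a b where \<phi>: "h = elt \<phi> k" "fits n \<phi> k a b"
    using Suc.IH[OF h(1)] by blast
  consider i where "s = lamp i" "\<bar>i\<bar> = 1" | i where "s = shift i" "\<bar>i\<bar> = 1"
    using h(2) by (force simp: letters)
  then show ?case
    using \<phi> h(3) fits_lamp[OF \<phi>(2)] fits_shift[OF \<phi>(2)] by cases (metis elt_lamp elt_shift)+
qed

lemma spells_lamp: "spells W S (nat \<bar>i\<bar>) (lamp i)"
  by (rule W.spells_one_parameter_subgroup[OF S_closed]) (auto simp: letters lamp_0 lamp_add)

lemma spells_shift: "spells W S (nat \<bar>i\<bar>) (shift i)"
  by (rule W.spells_one_parameter_subgroup[OF S_closed]) (auto simp: letters shift_0 shift_add)

text \<open>One pass in direction \<open>s\<close>, setting every lamp when it is reached, the one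
  at 0 before the first step; the pass itself costs \<open>m\<close> shifts.\<close>

lemma spells_sweep:
  fixes \<phi> :: "int \<Rightarrow> int"
  assumes s: "s = 1 \<or> s = - 1"
  shows "spells W S ((\<Sum>i\<le>m. nat \<bar>\<phi> (s * int i)\<bar>) + m)
    (elt (\<lambda>x. if s * x \<in> {0..int m} then \<phi> x else 0) (s * int m))"
proof (induction m)
  case 0
  have "elt (\<lambda>x. if s * x \<in> {0..int 0} then \<phi> x else 0) (s * int 0) = lamp (\<phi> 0)"
    using s by (auto simp: lamp_def intro!: arg_cong2[of _ _ _ _ elt])
  then show ?case
    using spells_lamp[of "\<phi> 0"] by simp
next
  case (Suc m)
  let ?g = "\<lambda>m. elt (\<lambda>x. if s * x \<in> {0..int m} then \<phi> x else 0) (s * int m)"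
  have "spells W S (Suc 0) (shift s)"
    using spells_shift[of s] s by auto
  from W.spells_mult[OF S_closed W.spells_mult[OF S_closed Suc this] spells_lamp[of "\<phi> (s * int (Suc m))"]]
  have "spells W S ((\<Sum>i\<le>Suc m. nat \<bar>\<phi> (s * int i)\<bar>) + Suc m)
      (?g m \<otimes>\<^bsub>W\<^esub> shift s \<otimes>\<^bsub>W\<^esub> lamp (\<phi> (s * int (Suc m))))"
    by (simp add: add_ac)
  also have "?g m \<otimes>\<^bsub>W\<^esub> shift s \<otimes>\<^bsub>W\<^esub> lamp (\<phi> (s * int (Suc m))) = ?g (Suc m)"
    using s by (auto simp: elt_shift elt_lamp algebra_simps intro!: arg_cong2[of _ _ _ _ elt] arg_cong[of _ _ \<phi>] ext)
  finally show ?case .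
qed

text \<open>For \<open>k \<ge> 0\<close> the walk is \<open>0 \<rightarrow> -a \<rightarrow> b \<rightarrow> k\<close>, for \<open>k < 0\<close> it is \<open>0 \<rightarrow> b \<rightarrow> -a \<rightarrow> k\<close>.\<close>

lemma fits_imp_spells:
  assumes "fits n \<phi> k a b"
  shows "\<exists>m\<le>n. spells W S m (elt \<phi> k)"
proof -
  define s where "s = (if 0 \<le> k then 1 else - 1 :: int)"
  \<comment> \<open>The end of the hull that is visited first, on the side away from
    \<open>k\<close>; \<open>\<psi>\<close> is the configuration as seen from there.\<close>
  define p where "p = (if 0 \<le> k then - a else b)"
  define m :: nat where "m = nat (a + b)"
  define \<psi> where "\<psi> x = \<phi> (x + p)" for x
  have s: "s = 1 \<or> s = - 1"
    by (simp add: s_def)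
  have f: "0 \<le> a" "0 \<le> b" "- a \<le> k" "k \<le> b" "\<And>x. \<phi> x \<noteq> 0 \<Longrightarrow> x \<in> {-a..b}"
    "l1_norm \<phi> + 2 * a + 2 * b - \<bar>k\<bar> \<le> int n"
    using assms by (auto simp: fits_def)
  have "int (\<Sum>i\<le>m. nat \<bar>\<psi> (s * int i)\<bar>) = (\<Sum>i\<le>m. \<bar>\<phi> (s * int i + p)\<bar>)"
    by (simp add: \<psi>_def)
  also have "\<dots> = (\<Sum>x\<in>{-a..b}. \<bar>\<phi> x\<bar>)"
    by (rule sum.reindex_bij_witness[of _ "\<lambda>x. nat (s * (x - p))" "\<lambda>i. s * int i + p"])
      (use f in \<open>auto simp: s_def p_def m_def\<close>)
  also have "\<dots> = l1_norm \<phi>"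
    using f by (intro l1_norm_eq[symmetric]) auto
  finally have len: "int (\<Sum>i\<le>m. nat \<bar>\<psi> (s * int i)\<bar>) = l1_norm \<phi>" .
  have "(\<lambda>x. if s * x \<in> {0..int m} then \<psi> x else 0) = \<psi>"
    using f(1,2) f(5) by (force simp: \<psi>_def s_def p_def m_def)
  with spells_sweep[OF s, of \<psi> m]
  have sweep: "spells W S ((\<Sum>i\<le>m. nat \<bar>\<psi> (s * int i)\<bar>) + m) (elt \<psi> (s * int m))"
    by simp
  \<comment> \<open>After the sweep the walker stands at the other end \<open>p + s * m\<close>;
    \<open>?q\<close> is the way back to \<open>k\<close>.\<close>
  let ?q = "k - p - s * int m"
  have "shift p \<otimes>\<^bsub>W\<^esub> elt \<psi> (s * int m) \<otimes>\<^bsub>W\<^esub> shift ?q = elt \<phi> k"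
    by (simp add: shift_elt elt_shift \<psi>_def)
  with W.spells_mult[OF S_closed W.spells_mult[OF S_closed spells_shift[of p] sweep] spells_shift[of ?q]]
  have "spells W S (nat \<bar>p\<bar> + ((\<Sum>i\<le>m. nat \<bar>\<psi> (s * int i)\<bar>) + m) + nat \<bar>?q\<bar>) (elt \<phi> k)"
    by simp
  \<comment> \<open>The three legs have \<open>a\<close>, \<open>a + b\<close>, \<open>b - k\<close>
    steps for \<open>k \<ge> 0\<close> and \<open>b\<close>, \<open>a + b\<close>,
    \<open>a + k\<close> steps for \<open>k < 0\<close>: in both cases
    \<open>2 * a + 2 * b - |k|\<close>.\<close>
  moreover have "int (nat \<bar>p\<bar> + ((\<Sum>i\<le>m. nat \<bar>\<psi> (s * int i)\<bar>) + m) + nat \<bar>?q\<bar>) \<le> int n"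
    unfolding of_nat_add len using f by (auto simp: s_def p_def m_def)
  ultimately show ?thesis
    using zle_int by blast
qed

section \<open>Generation and description of the balls\<close>

lemma ex_fits:
  assumes "finite {x. \<phi> x \<noteq> 0}"
  shows "\<exists>n a b. fits n \<phi> k a b"
proof -
  \<comment> \<open>A crude common bound for \<open>|k|\<close> and all positions in the support;
    the hull \<open>[-M, M]\<close> costs at most \<open>4 * M\<close>.\<close>
  define M where "M = \<bar>k\<bar> + (\<Sum>x | \<phi> x \<noteq> 0. \<bar>x\<bar>)"
  have "\<bar>x\<bar> \<le> M" if "\<phi> x \<noteq> 0" for x
    using member_le_sum[of x "{x. \<phi> x \<noteq> 0}" abs] assms that by (simp add: M_def)
  moreover have "\<bar>k\<bar> \<le> M" "0 \<le> M"
    by (simp_all add: M_def sum_nonneg)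
  ultimately have "fits (nat (l1_norm \<phi> + 4 * M)) \<phi> k M M"
    using l1_norm_nonneg[of \<phi>] by (auto simp: fits_def abs_le_iff minus_le_iff)
  then show ?thesis by blast
qed

lemma ex_spells:
  assumes "g \<in> carrier W"
  shows "\<exists>n. spells W S n g"
  by (metis assms elt_cases ex_fits fits_imp_spells)

lemma finite_generating_set_S: "finite_generating_set W S"
proof -
  have "carrier W \<subseteq> generate W S"
    using ex_spells W.spells_in_generate[OF S_closed] by blast
  then show ?thesis
    using S_closed W.generate_incl[OF S_closed] by (auto simp: finite_generating_set_def S_def)
qed

lemma word_ball_eq: "word_ball W S n = {g. \<exists>l\<le>n. spells W S l g}"
  using ex_spells word_length_le_iff[of W S] W.spells_closed[OF S_closed]
  unfolding word_ball_def by blast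

lemma finite_word_ball: "finite (word_ball W S n)"
  unfolding word_ball_eq by (rule W.finite_spells) (simp add: S_def)

lemma fits_mono: "fits l \<phi> k a b \<Longrightarrow> l \<le> n \<Longrightarrow> fits n \<phi> k a b"
  by (auto simp: fits_def)

text \<open>Joins the lower and the upper bound for word length; the counting below uses balls only
  through this description and their finiteness.\<close>

lemma mem_word_ball_iff: "g \<in> word_ball W S n \<longleftrightarrow> (\<exists>\<phi> k a b. g = elt \<phi> k \<and> fits n \<phi> k a b)"
  unfolding word_ball_eq using spells_imp_fits fits_imp_spells fits_mono by blast

section \<open>Centralizers and commuting pairs\<close>

lemma C_commute:
  assumes "x \<in> carrier C" "y \<in> carrier C"
  shows "x \<otimes>\<^bsub>C\<^esub> y = y \<otimes>\<^bsub>C\<^esub> x"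
proof -
  obtain i j :: int where "x = c [^]\<^bsub>C\<^esub> i" "y = c [^]\<^bsub>C\<^esub> j"
    using assms carrier_eq by auto
  then show ?thesis
    by (metis pow_add add.commute)
qed

lemma snd_mult: "snd (g \<otimes>\<^bsub>W\<^esub> h) = snd g + snd h"
  by (cases g, cases h) (simp add: mult_W)

lemma snd_inv:
  assumes "g \<in> carrier W"
  shows "snd (inv\<^bsub>W\<^esub> g) = - snd g"
  using snd_mult[of g "inv\<^bsub>W\<^esub> g"] assms by (simp add: one_W elt_def)

text \<open>A lamp configuration invariant under a non-trivial translation has empty or infinite support.\<close>

lemma base_commutes_imp_one:
  assumes u: "u \<in> carrier W" "snd u = 0" and g: "g \<in> carrier W" "snd g \<noteq> 0"
    and comm: "u \<otimes>\<^bsub>W\<^esub> g = g \<otimes>\<^bsub>W\<^esub> u"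
  shows "u = \<one>\<^bsub>W\<^esub>"
proof -
  obtain f where f: "u = (f, 0)" "\<And>h. f h \<in> carrier C" "finite {h. f h \<noteq> \<one>\<^bsub>C\<^esub>}"
    using u by (cases u) (auto simp: carrier_W)
  obtain p k where p: "g = (p, k)" "\<And>h. p h \<in> carrier C" "k \<noteq> 0"
    using g by (cases g) (auto simp: carrier_W)
  \<comment> \<open>Lamps at \<open>h\<close> are compared in both products; \<open>p h\<close>
    cancels because \<open>C\<close> is abelian.\<close>
  have step: "f (h + k) = f h" for h
  proof -
    have "f h \<otimes>\<^bsub>C\<^esub> p h = p h \<otimes>\<^bsub>C\<^esub> f (h + k)"
      using comm by (simp add: f(1) p(1) mult_W fun_eq_iff)
    then have "p h \<otimes>\<^bsub>C\<^esub> f h = p h \<otimes>\<^bsub>C\<^esub> f (h + k)"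
      using C_commute f(2) p(2) by metis
    then show ?thesis
      using f(2) p(2) C.l_cancel by metis
  qed
  have periodic: "f (h + int n * k) = f h" for h n
  proof (induction n)
    case (Suc n)
    then show ?case
      using step[of "h + int n * k"] by (simp add: algebra_simps)
  qed simp
  have "f h = \<one>\<^bsub>C\<^esub>" for h
  proof (rule ccontr)
    assume "f h \<noteq> \<one>\<^bsub>C\<^esub>"
    then have "range (\<lambda>n. h + int n * k) \<subseteq> {h. f h \<noteq> \<one>\<^bsub>C\<^esub>}"
      using periodic by auto
    moreover have "inj (\<lambda>n. h + int n * k)"
      using p(3) by (auto simp: inj_on_def)
    ultimately show False
      using f(3) by (meson finite_subset range_inj_infinite)
  qed
  then show ?thesis
    by (auto simp: f(1) one_W elt_def)
qed

lemma snd_word_ball: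
  assumes "g \<in> word_ball W S n"
  shows "snd g \<in> {- int n..int n}"
proof -
  obtain \<phi> k a b where g: "g = elt \<phi> k" "fits n \<phi> k a b"
    using assms by (auto simp: mem_word_ball_iff)
  then show ?thesis
    using l1_norm_nonneg[of \<phi>] by (auto simp: fits_def elt_def)
qed

lemma word_ball_closed: "word_ball W S n \<subseteq> carrier W"
  by (auto simp: word_ball_def)

definition base_ball :: "nat \<Rightarrow> ((int \<Rightarrow> 'a) \<times> int) set"
  where "base_ball n = {g \<in> word_ball W S n. snd g = 0}"

lemma finite_base_ball: "finite (base_ball n)"
  by (simp add: base_ball_def finite_word_ball)

text \<open>If \<open>h\<close> and \<open>h'\<close> commute with \<open>g\<close> and have the
  same image in the head, their quotient is a base element commuting with \<open>g\<close>, hence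
  trivial. So \<open>snd\<close> is injective on the centralizer, and it maps the ball into
  \<open>[-n, n]\<close>.\<close>

lemma card_centralizer_le:
  assumes g: "g \<in> carrier W" "snd g \<noteq> 0"
  shows "card {h \<in> word_ball W S n. g \<otimes>\<^bsub>W\<^esub> h = h \<otimes>\<^bsub>W\<^esub> g} \<le> 2 * n + 1"
proof -
  let ?Z = "{h \<in> word_ball W S n. g \<otimes>\<^bsub>W\<^esub> h = h \<otimes>\<^bsub>W\<^esub> g}"
  have "inj_on snd ?Z"
  proof (rule inj_onI)
    fix h h' assume h: "h \<in> ?Z" "h' \<in> ?Z" "snd h = snd h'"
    then have carr: "h \<in> carrier W" "h' \<in> carrier W"
      using word_ball_closed by auto
    let ?u = "h \<otimes>\<^bsub>W\<^esub> inv\<^bsub>W\<^esub> h'"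
    have "inv\<^bsub>W\<^esub> h' \<otimes>\<^bsub>W\<^esub> g = g \<otimes>\<^bsub>W\<^esub> inv\<^bsub>W\<^esub> h'"
      using h(2) carr g W.inv_solve_left' W.inv_solve_right' W.m_assoc
      by (smt (verit) W.inv_closed W.m_closed mem_Collect_eq)
    then have "?u \<otimes>\<^bsub>W\<^esub> g = g \<otimes>\<^bsub>W\<^esub> ?u"
      using h(1) carr g by (metis (mono_tags, lifting) W.inv_closed W.m_assoc mem_Collect_eq)
    moreover have "snd ?u = 0"
      using h(3) carr by (simp add: snd_mult snd_inv)
    ultimately have "?u = \<one>\<^bsub>W\<^esub>"
      using base_commutes_imp_one g carr by blast
    then show "h = h'"
      using carr by (metis W.inv_equality W.inv_inv W.inv_closed)
  qed
  moreover have "snd ` ?Z \<subseteq> {- int n..int n}"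
    using snd_word_ball by blast
  ultimately have "card ?Z \<le> card {- int n..int n}"
    by (intro card_inj_on_le) auto
  then show ?thesis
    by simp
qed

text \<open>Pairs are sorted by the first entry: outside the base (\<open>?R\<close>), the identity
  (\<open>?Q\<close>), or a non-trivial base element, which forces the second entry into the base
  (\<open>?P\<close>). The identity accounts for the step from \<open>2 * n + 1\<close> to
  \<open>2 * n + 2\<close>.\<close>

lemma card_commuting_le:
  "card {(g, h) \<in> word_ball W S n \<times> word_ball W S n. g \<otimes>\<^bsub>W\<^esub> h = h \<otimes>\<^bsub>W\<^esub> g}
    \<le> (card (base_ball n))\<^sup>2 + (2 * n + 2) * card (word_ball W S n)"
proof -
  let ?B = "word_ball W S n"
  let ?Z = "\<lambda>g. {h \<in> ?B. g \<otimes>\<^bsub>W\<^esub> h = h \<otimes>\<^bsub>W\<^esub> g}"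
  let ?P = "base_ball n \<times> base_ball n" and ?Q = "{\<one>\<^bsub>W\<^esub>} \<times> ?B"
    and ?R = "SIGMA g:?B - base_ball n. ?Z g"
  have fin: "finite ?P" "finite ?Q" "finite ?R"
    by (auto intro!: finite_SigmaI simp: finite_word_ball finite_base_ball)
  have "{(g, h) \<in> ?B \<times> ?B. g \<otimes>\<^bsub>W\<^esub> h = h \<otimes>\<^bsub>W\<^esub> g} \<subseteq> ?P \<union> ?Q \<union> ?R"
  proof
    fix x assume "x \<in> {(g, h) \<in> ?B \<times> ?B. g \<otimes>\<^bsub>W\<^esub> h = h \<otimes>\<^bsub>W\<^esub> g}"
    then obtain g h where x: "x = (g, h)" and gh: "g \<in> ?B" "h \<in> ?B" "g \<otimes>\<^bsub>W\<^esub> h = h \<otimes>\<^bsub>W\<^esub> g"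
      by blast
    then have carr: "g \<in> carrier W" "h \<in> carrier W"
      using word_ball_closed by auto
    consider "snd g \<noteq> 0" | "g = \<one>\<^bsub>W\<^esub>" | "snd g = 0" "snd h = 0"
      using base_commutes_imp_one[OF carr(1) _ carr(2) _ gh(3)] by blast
    then show "x \<in> ?P \<union> ?Q \<union> ?R"
      by cases (use gh in \<open>simp_all add: x base_ball_def\<close>)
  qed
  then have "card {(g, h) \<in> ?B \<times> ?B. g \<otimes>\<^bsub>W\<^esub> h = h \<otimes>\<^bsub>W\<^esub> g} \<le> card (?P \<union> ?Q \<union> ?R)"
    using fin by (intro card_mono) auto
  also have "\<dots> \<le> card ?P + card ?Q + card ?R"
    by (meson add_mono_thms_linordered_semiring(3) card_Un_le le_trans)
  also have "card ?P = (card (base_ball n))\<^sup>2"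
    by (simp add: card_cartesian_product power2_eq_square)
  also have "card ?Q = card ?B"
    by (simp add: card_cartesian_product)
  also have "card ?R = (\<Sum>g\<in>?B - base_ball n. card (?Z g))"
    by (rule card_SigmaI) (auto simp: finite_word_ball)
  also have "\<dots> \<le> (\<Sum>g\<in>?B - base_ball n. 2 * n + 1)"
    using word_ball_closed[of n] by (intro sum_mono card_centralizer_le) (auto simp: base_ball_def)
  also have "\<dots> = (2 * n + 1) * card (?B - base_ball n)"
    by simp
  also have "\<dots> \<le> (2 * n + 1) * card ?B"
    by (intro mult_left_mono card_mono finite_word_ball) auto
  finally show ?thesis
    by (simp add: algebra_simps)
qed

section \<open>Near and far elements of the base\<close>

text \<open>
  If the walker of a base element has to reach \<open>\<plusminus>M\<close>, then it may stop at any of \<open>M + 1\<close> places on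
  the way back without leaving the ball, so such elements have density at most \<open>1 / (M + 1)\<close>.
\<close>

lemma card_far_le:
  fixes M n :: nat
  defines "F \<equiv> {g \<in> base_ball n. \<exists>\<phi> a b. g = elt \<phi> 0 \<and> fits n \<phi> 0 a b \<and> (int M \<le> a \<or> int M \<le> b)}"
  shows "card F * (M + 1) \<le> card (word_ball W S n)"
proof -
  \<comment> \<open>One side is fixed for each element, so that the image determines first
    \<open>g\<close> by its lamps, then the sign, then \<open>j\<close>.\<close>
  define right where "right g \<longleftrightarrow> (\<exists>\<phi> a b. g = elt \<phi> 0 \<and> fits n \<phi> 0 a b \<and> int M \<le> b)" for g
  define s where "s g = (if right g then 1 else - 1 :: int)" for g
  let ?f = "\<lambda>(g, j). (fst g, s g * int j)"
  have "inj_on ?f (F \<times> {0..M})"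
  proof (rule inj_onI, clarify)
    fix p k j p' k' j'
    assume *: "(p, k) \<in> F" "(p', k') \<in> F" "fst (p, k) = fst (p', k')"
      "s (p, k) * int j = s (p', k') * int j'"
    then have "p = p'" "k = k'"
      by (auto simp: F_def base_ball_def)
    with *(4) show "(p, k) = (p', k') \<and> j = j'"
      by (auto simp: s_def split: if_splits)
  qed
  moreover have "?f ` (F \<times> {0..M}) \<subseteq> word_ball W S n"
  proof
    fix x assume "x \<in> ?f ` (F \<times> {0..M})"
    then obtain g j where x: "x = (fst g, s g * int j)" "g \<in> F" "j \<le> M"
      by auto
    obtain \<phi> a b where \<phi>: "g = elt \<phi> 0" "fits n \<phi> 0 a b" "if right g then int M \<le> b else int M \<le> a"
    proof (cases "right g")
      case True
      then obtain \<phi> a b where "g = elt \<phi> 0" "fits n \<phi> 0 a b" "int M \<le> b"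
        unfolding right_def by blast
      with True that show thesis by simp
    next
      case False
      with \<open>g \<in> F\<close> obtain \<phi> a b where "g = elt \<phi> 0" "fits n \<phi> 0 a b" "int M \<le> a"
        unfolding F_def right_def by blast
      with False that show thesis by simp
    qed
    \<comment> \<open>The same hull serves: the new end point lies in it, and stopping there saves
      \<open>j\<close> steps of the return to 0.\<close>
    then have "fits n \<phi> (s g * int j) a b"
      using \<open>j \<le> M\<close> by (auto simp: fits_def s_def split: if_splits)
    moreover have "x = elt \<phi> (s g * int j)"
      using \<phi>(1) x(1) by (simp add: elt_def)
    ultimately show "x \<in> word_ball W S n"
      unfolding mem_word_ball_iff by blast
  qed
  ultimately have "card (F \<times> {0..M}) \<le> card (word_ball W S n)"
    by (intro card_inj_on_le finite_word_ball)
  then show ?thesis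
    by (simp add: card_cartesian_product)
qed

text \<open>A single exponent cannot exceed the total weight, so each of the
  \<open>2 * M + 1\<close> positions admits at most \<open>2 * n + 1\<close> values. For fixed
  \<open>M\<close> this is polynomial in \<open>n\<close>.\<close>

lemma card_near_le:
  fixes M n :: nat
  shows "card {g. \<exists>\<phi> a b. g = elt \<phi> 0 \<and> fits n \<phi> 0 a b \<and> a \<le> int M \<and> b \<le> int M} \<le> (2 * n + 1) ^ (2 * M + 1)"
    (is "card ?E \<le> _")
proof -
  let ?I = "{- int M..int M}" and ?J = "{- int n..int n}"
  let ?f = "\<lambda>\<psi>. elt (\<lambda>x. if x \<in> ?I then \<psi> x else 0) 0"
  have "?E \<subseteq> ?f ` (?I \<rightarrow>\<^sub>E ?J)"
  proof
    fix g assume "g \<in> ?E"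
    then obtain \<phi> a b where g: "g = elt \<phi> 0" and *: "fits n \<phi> 0 a b" "a \<le> int M" "b \<le> int M"
      by blast
    have supp: "\<And>x. \<phi> x \<noteq> 0 \<Longrightarrow> x \<in> ?I"
      using * by (force simp: fits_def)
    have "\<bar>\<phi> x\<bar> \<le> l1_norm \<phi>" if "x \<in> ?I" for x
      using l1_norm_eq[of ?I \<phi>] supp member_le_sum[of x ?I "\<lambda>x. \<bar>\<phi> x\<bar>"] that by simp
    then have "\<bar>\<phi> x\<bar> \<le> int n" if "x \<in> ?I" for x
      using that *(1) by (force simp: fits_def)
    then have "restrict \<phi> ?I \<in> ?I \<rightarrow>\<^sub>E ?J"
      by (auto simp: abs_le_iff minus_le_iff)
    moreover have "g = ?f (restrict \<phi> ?I)"
      unfolding g using supp by (intro arg_cong2[of _ _ _ _ elt] ext) auto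
    ultimately show "g \<in> ?f ` (?I \<rightarrow>\<^sub>E ?J)"
      by blast
  qed
  then have "card ?E \<le> card (?f ` (?I \<rightarrow>\<^sub>E ?J))"
    by (intro card_mono finite_imageI finite_PiE) auto
  also have "\<dots> \<le> card (?I \<rightarrow>\<^sub>E ?J)"
    by (intro card_image_le finite_PiE) auto
  also have "\<dots> = (2 * n + 1) ^ (2 * M + 1)"
  proof -
    have "card ?J = 2 * n + 1" "card ?I = 2 * M + 1"
      by auto
    then show ?thesis
      by (simp only: card_PiE finite_atLeastAtMost_int prod_constant)
  qed
  finally show ?thesis .
qed

text \<open>Near and far elements may overlap, since hulls are not unique and both conditions allow
  equality with \<open>M\<close>; covering the base ball suffices for an upper bound.\<close>

lemma card_base_ball_le:
  "real (card (base_ball n)) \<le>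
    (2 * real n + 1) ^ (2 * M + 1) + real (card (word_ball W S n)) / (real M + 1)"
proof -
  let ?F = "{g \<in> base_ball n. \<exists>\<phi> a b. g = elt \<phi> 0 \<and> fits n \<phi> 0 a b \<and> (int M \<le> a \<or> int M \<le> b)}"
  let ?E = "{g. \<exists>\<phi> a b. g = elt \<phi> 0 \<and> fits n \<phi> 0 a b \<and> a \<le> int M \<and> b \<le> int M}"
  have sub: "?E \<subseteq> base_ball n"
    by (auto simp: base_ball_def mem_word_ball_iff elt_def)
  have "base_ball n \<subseteq> ?E \<union> ?F"
  proof
    fix g assume g: "g \<in> base_ball n"
    then obtain \<phi> k a b where *: "g = elt \<phi> k" "fits n \<phi> k a b"
      by (auto simp: base_ball_def mem_word_ball_iff)
    moreover have "k = 0"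
      using g * by (simp add: base_ball_def elt_def)
    moreover have "(a \<le> int M \<and> b \<le> int M) \<or> (int M \<le> a \<or> int M \<le> b)"
      by linarith
    ultimately show "g \<in> ?E \<union> ?F"
      using g by blast
  qed
  then have "card (base_ball n) \<le> card (?E \<union> ?F)"
    using finite_subset[OF sub finite_base_ball] finite_base_ball by (intro card_mono) auto
  also have "\<dots> \<le> card ?E + card ?F"
    by (rule card_Un_le)
  finally have "real (card (base_ball n)) \<le> real (card ?E) + real (card ?F)"
    by linarith
  also have "real (card ?E) \<le> real ((2 * n + 1) ^ (2 * M + 1))"
    by (intro of_nat_mono card_near_le)
  also have "real ((2 * n + 1) ^ (2 * M + 1)) = (2 * real n + 1) ^ (2 * M + 1)"
    by (simp only: of_nat_power of_nat_add of_nat_mult of_nat_1 of_nat_numeral)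
  also have "real (card ?F) \<le> real (card (word_ball W S n)) / (real M + 1)"
  proof -
    have "real (card ?F * (M + 1)) \<le> real (card (word_ball W S n))"
      by (intro of_nat_mono card_far_le)
    then show ?thesis
      by (simp add: field_simps)
  qed
  finally show ?thesis
    by simp
qed

section \<open>Exponential growth and passage to the limit\<close>

lemma card_word_ball_ge: "2 ^ (n div 2) \<le> card (word_ball W S n)"
proof -
  define m where "m = n div 2"
  define \<chi> :: "int set \<Rightarrow> int \<Rightarrow> int" where "\<chi> A x = (if x \<in> A then 1 else 0)" for A x
  \<comment> \<open>\<open>A\<close> is the set of lit lamps. Walking from 0 to \<open>m\<close>
    takes \<open>m\<close> steps and at most \<open>m\<close> lamp moves, which stays within
    \<open>n\<close>.\<close>
  let ?f = "\<lambda>A. elt (\<chi> A) (int m)"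
  have "inj_on ?f (Pow {1..int m})"
  proof (rule inj_onI)
    fix A B assume "?f A = ?f B"
    \<comment> \<open>Evaluating at \<open>- x\<close> undoes the reflection built into
      \<open>elt\<close>.\<close>
    then have "c [^]\<^bsub>C\<^esub> \<chi> A (- (- x)) = c [^]\<^bsub>C\<^esub> \<chi> B (- (- x))" for x
      unfolding elt_def prod.inject fun_eq_iff by blast
    then have "c [^]\<^bsub>C\<^esub> \<chi> A x = c [^]\<^bsub>C\<^esub> \<chi> B x" for x
      by simp
    then have "x \<in> A \<longleftrightarrow> x \<in> B" for x
      using c_not_one C.int_pow_1[OF c_closed] by (metis \<chi>_def int_pow_0)
    then show "A = B"
      by blast
  qed
  moreover have "?f ` Pow {1..int m} \<subseteq> word_ball W S n"
  proof (rule image_subsetI)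
    fix A assume A: "A \<in> Pow {1..int m}"
    have "l1_norm (\<chi> A) = (\<Sum>x\<in>{1..int m}. \<bar>\<chi> A x\<bar>)"
      using A by (intro l1_norm_eq) (auto simp: \<chi>_def split: if_splits)
    also have "\<dots> \<le> (\<Sum>x\<in>{1..int m}. 1)"
      by (intro sum_mono) (auto simp: \<chi>_def)
    finally have "fits n (\<chi> A) (int m) 0 (int m)"
      using A by (auto simp: fits_def m_def \<chi>_def split: if_splits)
    then show "?f A \<in> word_ball W S n"
      by (auto simp: mem_word_ball_iff)
  qed
  ultimately have "card (Pow {1..int m}) \<le> card (word_ball W S n)"
    by (intro card_inj_on_le finite_word_ball)
  then show ?thesis
    by (simp add: card_Pow m_def)
qed

lemma card_word_ball_pos: "0 < card (word_ball W S n)"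
  using card_word_ball_ge[of n] by (rule less_le_trans[rotated]) simp

lemma power_over_word_ball_tendsto_0:
  "(\<lambda>n. (2 * real n + 1) ^ k / real (card (word_ball W S n))) \<longlonglongrightarrow> 0"
proof (rule tendsto_sandwich[OF _ _ tendsto_const])
  \<comment> \<open>The exponent \<open>(n - 1) / 2\<close> is a lower bound for
    \<open>n div 2\<close> that is free of integer division.\<close>
  show "(\<lambda>n::nat. (2 * real n + 1) ^ k / 2 powr ((real n - 1) / 2)) \<longlonglongrightarrow> 0"
    by real_asymp
  have "2 powr ((real n - 1) / 2) \<le> real (card (word_ball W S n))" for n
  proof -
    have "n \<le> 2 * (n div 2) + 1"
      by linarith
    then have "real n \<le> real (2 * (n div 2) + 1)"
      by (rule of_nat_mono)
    also have "\<dots> = 2 * real (n div 2) + 1"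
      by (simp only: of_nat_add of_nat_mult of_nat_1 of_nat_numeral)
    finally have "(real n - 1) / 2 \<le> real (n div 2)"
      by simp
    then have "2 powr ((real n - 1) / 2) \<le> 2 powr real (n div 2)"
      by (intro powr_mono) auto
    also have "\<dots> = real (2 ^ (n div 2))"
      by (simp add: powr_realpow)
    also have "\<dots> \<le> real (card (word_ball W S n))"
      by (intro of_nat_mono card_word_ball_ge)
    finally show ?thesis .
  qed
  then show "\<forall>\<^sub>F n in sequentially. (2 * real n + 1) ^ k / real (card (word_ball W S n)) \<le>
      (2 * real n + 1) ^ k / 2 powr ((real n - 1) / 2)"
    by (intro always_eventually allI divide_left_mono) (auto simp: card_word_ball_pos)
qed (auto intro!: always_eventually)

text \<open>First \<open>M\<close> is chosen so that the far part is below \<open>r / 2\<close>;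
  with \<open>M\<close> now fixed, the near part is polynomial over exponential and drops below
  \<open>r / 2\<close> for large \<open>n\<close>.\<close>

lemma base_density_tendsto_0:
  "(\<lambda>n. real (card (base_ball n)) / real (card (word_ball W S n))) \<longlonglongrightarrow> 0"
proof (rule LIMSEQ_I)
  fix r :: real assume r: "0 < r"
  obtain M :: nat where M: "inverse (real (Suc M)) < r / 2"
    using reals_Archimedean[of "r / 2"] r by auto
  have "\<forall>\<^sub>F n in sequentially. (2 * real n + 1) ^ (2 * M + 1) / real (card (word_ball W S n)) < r / 2"
    by (rule order_tendstoD(2)[OF power_over_word_ball_tendsto_0]) (use r in simp)
  then obtain N where N: "(2 * real n + 1) ^ (2 * M + 1) / real (card (word_ball W S n)) < r / 2"
    if "n \<ge> N" for n
    unfolding eventually_sequentially by blast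
  have "real (card (base_ball n)) / real (card (word_ball W S n)) < r" if "n \<ge> N" for n
  proof -
    have "real (card (base_ball n)) / real (card (word_ball W S n)) \<le>
      ((2 * real n + 1) ^ (2 * M + 1) + real (card (word_ball W S n)) / (real M + 1)) /
        real (card (word_ball W S n))"
      by (intro divide_right_mono card_base_ball_le) simp
    also have "\<dots> = (2 * real n + 1) ^ (2 * M + 1) / real (card (word_ball W S n)) + inverse (real (Suc M))"
      using card_word_ball_pos[of n] by (simp add: add_divide_distrib inverse_eq_divide add.commute)
    also have "\<dots> < r"
      using N[OF that] M by linarith
    finally show ?thesis .
  qed
  then show "\<exists>N. \<forall>n\<ge>N. norm (real (card (base_ball n)) / real (card (word_ball W S n)) - 0) < r"
    by auto
qed

lemma degree_of_commutativity_S: "degree_of_commutativity W S = 0"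
proof -
  let ?b = "\<lambda>n. real (card (word_ball W S n))" and ?p = "\<lambda>n. real (card (base_ball n))"
  let ?d = "\<lambda>n. real (card {(g, h) \<in> word_ball W S n \<times> word_ball W S n.
    g \<otimes>\<^bsub>W\<^esub> h = h \<otimes>\<^bsub>W\<^esub> g}) / (?b n)\<^sup>2"
  have "(\<lambda>n. (?p n / ?b n)\<^sup>2 + 2 * ((2 * real n + 1) ^ 1 / ?b n)) \<longlonglongrightarrow> 0\<^sup>2 + 2 * 0"
    by (intro tendsto_intros base_density_tendsto_0 power_over_word_ball_tendsto_0)
  then have lim: "(\<lambda>n. (?p n / ?b n)\<^sup>2 + 2 * ((2 * real n + 1) / ?b n)) \<longlonglongrightarrow> 0"
    by simp
  have "?d n \<le> (?p n / ?b n)\<^sup>2 + 2 * ((2 * real n + 1) / ?b n)" for n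
  proof -
    have "?d n \<le> real ((card (base_ball n))\<^sup>2 + (2 * n + 2) * card (word_ball W S n)) / (?b n)\<^sup>2"
      by (intro divide_right_mono of_nat_mono card_commuting_le) simp
    also have "\<dots> = (?p n / ?b n)\<^sup>2 + (2 * real n + 2) / ?b n"
      using card_word_ball_pos[of n] by (simp add: power2_eq_square field_simps)
    \<comment> \<open>The linear factor is enlarged to a multiple of \<open>2 * n + 1\<close>, the
      form whose quotient by the ball size is known to vanish.\<close>
    also have "\<dots> \<le> (?p n / ?b n)\<^sup>2 + (2 * (2 * real n + 1)) / ?b n"
      by (intro add_left_mono divide_right_mono) auto
    finally show ?thesis by simp
  qed
  then have "?d \<longlonglongrightarrow> 0"
    by (intro tendsto_sandwich[OF _ _ tendsto_const lim]) (auto intro!: always_eventually)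
  then have "(\<lambda>n. ereal (?d n)) \<longlonglongrightarrow> ereal 0"
    by (rule tendsto_ereal)
  then show ?thesis
    unfolding degree_of_commutativity_def
    by (metis (no_types, lifting) lim_imp_Limsup sequentially_bot zero_ereal_def)
qed

end

theorem theorem1:
  fixes C :: "'a monoid"
  assumes "group C" and "cyclic_group C" and "\<not> trivial_group C"
  defines "G \<equiv> restricted_wreath_product C integer_group"
  shows "\<exists>S. finite_generating_set G S \<and> degree_of_commutativity G S = 0"
proof -
  interpret C: group C by fact
  obtain c where c: "c \<in> carrier C" "carrier C = range (\<lambda>i::int. c [^]\<^bsub>C\<^esub> i)"
    using assms(2) by (auto simp: C.cyclic_group)
  have "c \<noteq> \<one>\<^bsub>C\<^esub>"
    using c assms(3) by (auto simp: trivial_group_def C.is_group)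
  then interpret lamplighter C c
    using c by unfold_locales
  show ?thesis
    using finite_generating_set_S degree_of_commutativity_S unfolding W_def G_def by blast
qed

end
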